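(* Let $X$ be an irreducible and reversible homogeneous continuous time Markov chain on a finite state space of size $n$, with infinitesimal generator $\mathbf{G}$ (sign convention $\mathbf{P}(\tau)=e^{-\mathbf{G}\tau}$) and stationary probability vector $\boldsymbol{\pi}$, and let $\mathbf{x}\in\mathbb{R}^n$ be the vector of real values attached to the states. Let $\{\omega_k\}_{1\le k\le n-1}$ be the non-zero eigenvalues of $\mathbf{G}$ (counted with multiplicity), and let $\boldsymbol{\Pi}_k$ be the spectral projector associated to the eigenvalue $\omega_k$. Then for every $\omega\in\mathbb{R}$ the power spectral density of $X$ is $$S_X(\omega)=\sum_{k=1}^{n-1}\gamma_k^2\,\frac{\omega_k}{\omega_k^2+\omega^2},\qquad \text{where } \gamma_k^2:=\langle \mathbf{x},\boldsymbol{\Pi}_k\mathbf{x}\rangle_{\boldsymbol{\pi}}.$$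
   Context: A homogeneous continuous time Markov chain (HCTMC) $X=\{X_t,t\ge 0\}$ on a finite state space $\{1,\dots,n\}$ has transition matrices $\mathbf{P}(\tau)$, $\mathbf{P}_{ij}(\tau)=P(X_\tau=j\mid X_0=i)$, with $\sum_j\mathbf{P}_{ij}(\tau)=1$. Its infinitesimal generator $\mathbf{G}$ is taken with the sign convention $\frac{d}{d\tau}\mathbf{P}(\tau)+\mathbf{G}\mathbf{P}(\tau)=\mathbf{0}$, $\mathbf{P}(0)=\mathds{1}$, i.e. $\mathbf{P}(\tau)=e^{-\mathbf{G}\tau}$; so $\sum_j\mathbf{G}_{ij}=0$ and off-diagonal entries are $\le 0$. Irreducibility gives a unique stationary probability vector $\boldsymbol{\pi}=(\pi_i)$, $\boldsymbol{\pi}\mathbf{G}=\mathbf{0}$, $\sum_i\pi_i=1$. The chain is reversible if $\pi_i\mathbf{G}_{ij}=\pi_j\mathbf{G}_{ji}$ for all $i,j$; a reversible process is taken to be stationary ($X_0$ has law $\boldsymbol{\pi}$). In this case $\mathbf{G}$ is self-adjoint for the scalar product $\langle\mathbf{u},\mathbf{v}\rangle_{\boldsymbol{\pi}}:=\sum_i\pi_iu_iv_i$ on $\mathbb{R}^n$, hence diagonalizable with real eigenvalues: $0$ (simple) and $n-1$ positive ones. The spectral projectors $\boldsymbol{\Pi}_1,\dots,\boldsymbol{\Pi}_{n-1}$ are the rank-one projectors, self-adjoint for $\langle\cdot,\cdot\rangle_{\boldsymbol{\pi}}$, onto the lines spanned by the vectors of a $\langle\cdot,\cdot\rangle_{\boldsymbol{\pi}}$-orthonormal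 family of eigenvectors for $\omega_1,\dots,\omega_{n-1}$, so $\boldsymbol{\Pi}_k\boldsymbol{\Pi}_l=\delta_{kl}\boldsymbol{\Pi}_k$ and $\mathbf{G}=\sum_{k=1}^{n-1}\omega_k\boldsymbol{\Pi}_k$. To each state $i$ a real value $x_i$ is attached, $\mathbf{x}=(x_i)$; averages of $X_t$ refer to the values, e.g. $\langle X_t\rangle=\sum_ix_iP(X_t=i)$ and $\langle X_{t+\tau}X_t\rangle=\sum_{i,j}x_ix_jP(X_{t+\tau}=j, X_t=i)$. The autocorrelation function is $\mathcal{C}_X(\tau):=\lim_{t\to\infty}\langle\delta X_{t+\tau}\,\delta X_t\rangle$ for $\tau\ge0$, with $\delta X_t:=X_t-\langle X_t\rangle$ (value-process minus mean), and the power spectral density is $S_X(\omega)=\int_0^\infty\mathcal{C}_X(\tau)\cos(\omega\tau)\,d\tau$. *)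

theory Defs
  imports "HOL-Probability.Probability" "HOL-Computational_Algebra.Polynomial"
begin

text \<open>
  The states are the elements of a finite type \<open>'n\<close>, so that \<open>n = CARD('n)\<close>.
  Only times \<open>t \<ge> 0\<close> carry meaning; \<open>X\<close> and \<open>P\<close> are unconstrained at negative times.

  \<open>X\<close> is the state process; the value process is \<open>\<lambda>t w. x $ X t w\<close>.  The Markov property
  conditions on the states at arbitrary finitely many times \<open>T\<close> before the present time \<open>s\<close>,
  and homogeneity is that the conditional probability depends on \<open>\<tau>\<close> only.
\<close>

locale hctmc = prob_space M for M :: "'w measure" +
  fixes X :: "real \<Rightarrow> 'w \<Rightarrow> 'n::finite"
    and P :: "real \<Rightarrow> real^'n^'n"
  assumes measurable_X: "\<And>t. 0 \<le> t \<Longrightarrow> X t \<in> measurable M (count_space UNIV)"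
    and transition_nonneg: "\<And>\<tau> i j. 0 \<le> \<tau> \<Longrightarrow> 0 \<le> P \<tau> $ i $ j"
    and transition_sum: "\<And>\<tau> i. 0 \<le> \<tau> \<Longrightarrow> (\<Sum>j\<in>UNIV. P \<tau> $ i $ j) = 1"
    and markov: "\<And>T f s \<tau> i j.
      \<lbrakk>finite T; T \<subseteq> {0..<s}; 0 \<le> s; 0 \<le> \<tau>;
       \<P>(w in M. X s w = i \<and> (\<forall>t\<in>T. X t w = f t)) > 0\<rbrakk> \<Longrightarrow>
      \<P>(w in M. X (s + \<tau>) w = j \<bar> X s w = i \<and> (\<forall>t\<in>T. X t w = f t)) = P \<tau> $ i $ j"

text \<open>Sign convention \<open>P \<tau> = exp (- G \<tau>)\<close>, expressed by the backward equation.\<close>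

definition is_generator :: "(real \<Rightarrow> real^'n^'n) \<Rightarrow> real^'n^'n::finite \<Rightarrow> bool" where
  "is_generator P G \<longleftrightarrow> P 0 = mat 1 \<and>
     (\<forall>\<tau>\<ge>0. (P has_vector_derivative - (G ** P \<tau>)) (at \<tau> within {0..}))"

definition irreducible_chain :: "(real \<Rightarrow> real^'n^'n::finite) \<Rightarrow> bool" where
  "irreducible_chain P \<longleftrightarrow> (\<forall>i j. \<exists>\<tau>\<ge>0. P \<tau> $ i $ j > 0)"

definition stationary_vector :: "real^'n^'n \<Rightarrow> real^'n::finite \<Rightarrow> bool" where
  "stationary_vector G \<pi> \<longleftrightarrow>
     (\<forall>i. 0 \<le> \<pi> $ i) \<and> (\<Sum>i\<in>UNIV. \<pi> $ i) = 1 \<and> \<pi> v* G = 0"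

text \<open>Reversibility includes that the process is started from \<open>\<pi>\<close>.\<close>

definition reversible_chain ::
  "'w measure \<Rightarrow> (real \<Rightarrow> 'w \<Rightarrow> 'n::finite) \<Rightarrow> real^'n^'n \<Rightarrow> real^'n \<Rightarrow> bool" where
  "reversible_chain M X G \<pi> \<longleftrightarrow>
     (\<forall>i j. \<pi> $ i * G $ i $ j = \<pi> $ j * G $ j $ i) \<and>
     (\<forall>i. \<P>(w in M. X 0 w = i) = \<pi> $ i)"

definition inner_wt :: "real^'n \<Rightarrow> real^'n \<Rightarrow> real^'n::finite \<Rightarrow> real" where
  "inner_wt \<pi> u v = (\<Sum>i\<in>UNIV. \<pi> $ i * u $ i * v $ i)"

definition char_polynomial :: "real^'n^'n::finite \<Rightarrow> real poly" where
  "char_polynomial A = det (\<chi> i j. (if i = j then [:0, 1:] else 0) - [:A $ i $ j:])"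

text \<open>
  The numbers \<open>\<omega>s 1, \<dots>, \<omega>s (n - 1)\<close> list the non-zero (real) eigenvalues, each one as often
  as its multiplicity as a root of the characteristic polynomial.
\<close>

definition nonzero_eigenvalues :: "real^'n^'n::finite \<Rightarrow> (nat \<Rightarrow> real) \<Rightarrow> bool" where
  "nonzero_eigenvalues G \<omega>s \<longleftrightarrow>
     filter_mset (\<lambda>z. z \<noteq> 0) (proots (char_polynomial G)) =
       image_mset \<omega>s (mset_set {1..CARD('n) - 1})"

definition spectral_projectors ::
  "real^'n \<Rightarrow> real^'n^'n \<Rightarrow> (nat \<Rightarrow> real) \<Rightarrow> (nat \<Rightarrow> real^'n^'n::finite) \<Rightarrow> bool" where
  "spectral_projectors \<pi> G \<omega>s Proj \<longleftrightarrow>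
     (\<exists>e :: nat \<Rightarrow> real^'n.
        (\<forall>k\<in>{1..CARD('n) - 1}. \<forall>l\<in>{1..CARD('n) - 1}.
           inner_wt \<pi> (e k) (e l) = (if k = l then 1 else 0)) \<and>
        (\<forall>k\<in>{1..CARD('n) - 1}.
           G *v e k = \<omega>s k *\<^sub>R e k \<and>
           Proj k ** Proj k = Proj k \<and>
           (\<forall>u v. inner_wt \<pi> (Proj k *v u) v = inner_wt \<pi> u (Proj k *v v)) \<and>
           range (\<lambda>v. Proj k *v v) = span {e k}))"

definition mean_value ::
  "'w measure \<Rightarrow> (real \<Rightarrow> 'w \<Rightarrow> 'n::finite) \<Rightarrow> real^'n \<Rightarrow> real \<Rightarrow> real" where
  "mean_value M X x t = (LINT w|M. x $ X t w)"

definition lagged_covariance ::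
  "'w measure \<Rightarrow> (real \<Rightarrow> 'w \<Rightarrow> 'n::finite) \<Rightarrow> real^'n \<Rightarrow> real \<Rightarrow> real \<Rightarrow> real" where
  "lagged_covariance M X x \<tau> t =
     (LINT w|M. (x $ X (t + \<tau>) w - mean_value M X x (t + \<tau>)) *
                (x $ X t w - mean_value M X x t))"

definition autocorrelation ::
  "'w measure \<Rightarrow> (real \<Rightarrow> 'w \<Rightarrow> 'n::finite) \<Rightarrow> real^'n \<Rightarrow> real \<Rightarrow> real" where
  "autocorrelation M X x \<tau> = Lim at_top (lagged_covariance M X x \<tau>)"

definition power_spectral_density ::
  "'w measure \<Rightarrow> (real \<Rightarrow> 'w \<Rightarrow> 'n::finite) \<Rightarrow> real^'n \<Rightarrow> real \<Rightarrow> real" where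
  "power_spectral_density M X x \<omega> =
     (LINT \<tau>:{0..}|lborel. autocorrelation M X x \<tau> * cos (\<omega> * \<tau>))"

text \<open>
  \<open>Lim\<close> and the Lebesgue integral are total; this predicate says that the limit and the
  integral in the definition above really exist.
\<close>

definition psd_exists ::
  "'w measure \<Rightarrow> (real \<Rightarrow> 'w \<Rightarrow> 'n::finite) \<Rightarrow> real^'n \<Rightarrow> real \<Rightarrow> bool" where
  "psd_exists M X x \<omega> \<longleftrightarrow>
     (\<forall>\<tau>\<ge>0. \<exists>c. (lagged_covariance M X x \<tau> \<longlongrightarrow> c) at_top) \<and>
     set_integrable lborel {0..} (\<lambda>\<tau>. autocorrelation M X x \<tau> * cos (\<omega> * \<tau>))"

end

theory Submission
  imports Defs
begin

text \<open>
  Reversibility makes \<open>G\<close> self-adjoint for \<open>\<langle>u, v\<rangle> = (\<Sum>i. \<pi>\<^sub>i u\<^sub>i v\<^sub>i)\<close>, so the matrix semigroup is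
  diagonal in an eigenbasis: if \<open>G e = c e\<close>, then \<open>t \<mapsto> \<langle>e, P(t) u\<rangle>\<close> solves the scalar equation
  \<open>a' = - c a\<close>, whence \<open>\<langle>e, P(t) u\<rangle> = exp (- c t) \<langle>e, u\<rangle>\<close>
  (\<open>generator_eigen_decay\<close>).  The constant vector \<open>1\<close> belongs to \<open>c = 0\<close>, and in this case the
  identity says that \<open>\<pi>\<close> is invariant under every \<open>P(t)\<close>; combined with irreducibility this forces
  \<open>\<pi> > 0\<close>, so that the form is positive definite.  The entries of \<open>P(t)\<close> stay in \<open>[0, 1]\<close>, which
  rules out exponential growth, so the non-zero eigenvalues are positive
  (\<open>generator_eigenvalue_nonneg\<close>).

  As the chain starts from \<open>\<pi>\<close>, the Markov property gives
  \<open>P(X\<^sub>t = i, X\<^bsub>t + \<tau>\<^esub> = j) = \<pi>\<^sub>i P(\<tau>)\<^sub>i\<^sub>j\<close>.  Hence the lagged covariance does not depend on \<open>t\<close> and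
  equals \<open>\<langle>x, P(\<tau>) x\<rangle> - \<langle>1, x\<rangle>\<^sup>2\<close> (\<open>stationary_lagged_covariance\<close>).  The vectors
  \<open>1, e\<^sub>1, \<dots>, e\<^bsub>n-1\<^esub>\<close> are orthonormal and \<open>n\<close> in number, hence a basis, and Parseval's identity
  (\<open>inner_wt_Parseval\<close>) turns this into \<open>\<Sum>k. \<langle>e\<^sub>k, x\<rangle>\<^sup>2 exp (- \<omega>\<^sub>k \<tau>)\<close>: the contribution of \<open>1\<close>
  is exactly the squared mean.  Finally \<open>\<langle>e\<^sub>k, x\<rangle>\<^sup>2 = \<langle>x, \<Pi>\<^sub>k x\<rangle>\<close>, and each exponential has the cosine
  transform \<open>\<omega>\<^sub>k / (\<omega>\<^sub>k\<^sup>2 + \<omega>\<^sup>2)\<close>.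
\<close>

section \<open>The cosine transform of a decaying exponential\<close>

lemma exp_cos_integrable_Ici:
  fixes a \<omega> :: real
  assumes "0 < a"
  shows "set_integrable lborel {0..} (\<lambda>t. exp (- a * t) * cos (\<omega> * t))"
proof (rule set_integrable_bound)
  have lim: "((\<lambda>t. - exp (- a * t) / a) \<longlongrightarrow> - 0 / a) at_top"
    by (intro tendsto_intros filterlim_compose[OF exp_at_bot]
        filterlim_tendsto_neg_mult_at_bot[OF tendsto_const] filterlim_ident) (use assms in auto)
  have "(\<integral>\<^sup>+t. ennreal (exp (- a * t)) * indicator {0..} t \<partial>lborel)
      = ennreal (0 - - exp (- a * 0) / a)"
    by (rule nn_integral_FTC_atLeast[where F = "\<lambda>t. - exp (- a * t) / a"])
      (use assms lim in \<open>auto intro!: derivative_eq_intros\<close>)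
  then have "has_bochner_integral lborel (\<lambda>t. indicator {0..} t *\<^sub>R exp (- a * t)) (1 / a)"
    by (intro has_bochner_integral_nn_integral)
      (use assms in \<open>auto simp: indicator_mult_ennreal mult.commute\<close>)
  then show "set_integrable lborel {0..} (\<lambda>t. exp (- a * t))"
    unfolding set_integrable_def by (rule integrable.intros)
  show "set_borel_measurable lborel {0..} (\<lambda>t. exp (- a * t) * cos (\<omega> * t))"
    unfolding set_borel_measurable_def by measurable
  show "AE t in lborel. t \<in> {0..} \<longrightarrow>
      norm (exp (- a * t) * cos (\<omega> * t)) \<le> norm (exp (- a * t))"
    by (intro AE_I2) (simp add: abs_mult mult_left_le)
qed

lemma exp_cos_integral_Ici:
  fixes a \<omega> :: real
  assumes "0 < a"
  shows "(LINT t:{0..}|lborel. exp (- a * t) * cos (\<omega> * t)) = a / (a\<^sup>2 + \<omega>\<^sup>2)"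
proof -
  define F where
    "F = (\<lambda>t. exp (- a * t) * ((\<omega> * sin (\<omega> * t) - a * cos (\<omega> * t)) / (a\<^sup>2 + \<omega>\<^sup>2)))"
  have deriv: "(F has_real_derivative exp (- a * t) * cos (\<omega> * t)) (at t within S)" for t S
  proof -
    have "((\<lambda>t. exp (- a * t) * (\<omega> * sin (\<omega> * t) - a * cos (\<omega> * t))) has_real_derivative
        exp (- a * t) * cos (\<omega> * t) * (a\<^sup>2 + \<omega>\<^sup>2)) (at t within S)"
      by (auto intro!: derivative_eq_intros simp: algebra_simps power2_eq_square)
    from DERIV_cdivide[OF this, of "a\<^sup>2 + \<omega>\<^sup>2"] show ?thesis
      using assms by (simp add: F_def)
  qed
  have exp_lim: "((\<lambda>t. exp (- a * t)) \<longlongrightarrow> 0) at_top"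
    by (intro filterlim_compose[OF exp_at_bot]
        filterlim_tendsto_neg_mult_at_bot[OF tendsto_const] filterlim_ident) (use assms in auto)
  have bound: "\<bar>(\<omega> * sin (\<omega> * t) - a * cos (\<omega> * t)) / (a\<^sup>2 + \<omega>\<^sup>2)\<bar> \<le> (\<bar>\<omega>\<bar> + \<bar>a\<bar>) / (a\<^sup>2 + \<omega>\<^sup>2)" for t
  proof -
    have "\<bar>\<omega> * sin (\<omega> * t) - a * cos (\<omega> * t)\<bar> \<le> \<bar>\<omega> * sin (\<omega> * t)\<bar> + \<bar>a * cos (\<omega> * t)\<bar>"
      by (rule abs_triangle_ineq4)
    also have "\<dots> \<le> \<bar>\<omega>\<bar> + \<bar>a\<bar>"
      by (intro add_mono) (auto simp: abs_mult mult_left_le)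
    finally show ?thesis
      by (simp add: divide_right_mono)
  qed
  have "(F \<longlongrightarrow> 0) at_top"
    unfolding F_def
  proof (rule Lim_null_comparison)
    show "\<forall>\<^sub>F t in at_top. norm (exp (- a * t) * ((\<omega> * sin (\<omega> * t) - a * cos (\<omega> * t)) / (a\<^sup>2 + \<omega>\<^sup>2)))
        \<le> exp (- a * t) * ((\<bar>\<omega>\<bar> + \<bar>a\<bar>) / (a\<^sup>2 + \<omega>\<^sup>2))"
      unfolding real_norm_def abs_mult abs_exp_cancel
      by (intro always_eventually allI mult_left_mono bound) simp
    show "((\<lambda>t. exp (- a * t) * ((\<bar>\<omega>\<bar> + \<bar>a\<bar>) / (a\<^sup>2 + \<omega>\<^sup>2))) \<longlongrightarrow> 0) at_top"
      using tendsto_mult_left_zero[OF exp_lim] .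
  qed
  then have "((\<lambda>b. F b - F 0) \<longlongrightarrow> 0 - F 0) at_top"
    by (intro tendsto_intros)
  moreover have "\<forall>\<^sub>F b in at_top. F b - F 0 = (LINT t:{0..b}|lborel. exp (- a * t) * cos (\<omega> * t))"
    using eventually_ge_at_top[of 0]
  proof eventually_elim
    case (elim b)
    show ?case
      unfolding set_lebesgue_integral_def
    proof (rule integral_FTC_atLeastAtMost[symmetric, OF elim])
      show "continuous_on {0..b} (\<lambda>t. exp (- a * t) * cos (\<omega> * t))"
        by (intro continuous_intros)
    qed (use deriv in \<open>simp add: has_real_derivative_iff_has_vector_derivative\<close>)
  qed
  ultimately have "((\<lambda>b. LINT t:{0..b}|lborel. exp (- a * t) * cos (\<omega> * t)) \<longlongrightarrow> 0 - F 0) at_top"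
    by (rule Lim_transform_eventually)
  moreover have "((\<lambda>b. LINT t:{0..b}|lborel. exp (- a * t) * cos (\<omega> * t))
      \<longlongrightarrow> (LINT t:{0..}|lborel. exp (- a * t) * cos (\<omega> * t))) at_top"
    by (intro tendsto_set_lebesgue_integral_at_top exp_cos_integrable_Ici assms) auto
  ultimately have "(LINT t:{0..}|lborel. exp (- a * t) * cos (\<omega> * t)) = 0 - F 0"
    by (intro tendsto_unique[OF trivial_limit_at_top_linorder])
  then show ?thesis
    by (simp add: F_def)
qed

section \<open>The weighted scalar product\<close>

lemma inner_wt_scaleR_right: "inner_wt \<pi> u (c *\<^sub>R v) = c * inner_wt \<pi> u v"
  by (simp add: inner_wt_def sum_distrib_left mult_ac)

lemma inner_wt_commute: "inner_wt \<pi> u v = inner_wt \<pi> v u"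
  by (simp add: inner_wt_def mult_ac)

text \<open>
  The map \<open>u \<mapsto> (sqrt \<pi>\<^sub>i u\<^sub>i)\<^sub>i\<close> is an isometry onto Euclidean space, where \<open>n\<close> orthonormal vectors
  span because they are independent.
\<close>

lemma inner_wt_Parseval:
  fixes \<pi> u v :: "real^'n::finite" and f :: "'k \<Rightarrow> real^'n"
  assumes pos: "\<And>i. 0 < \<pi> $ i"
    and fin: "finite I" and card_I: "card I = CARD('n)"
    and orth: "\<And>k l. k \<in> I \<Longrightarrow> l \<in> I \<Longrightarrow> inner_wt \<pi> (f k) (f l) = (if k = l then 1 else 0)"
  shows "inner_wt \<pi> u v = (\<Sum>k\<in>I. inner_wt \<pi> (f k) u * inner_wt \<pi> (f k) v)"
proof -
  define S :: "real^'n \<Rightarrow> real^'n" where "S w = (\<chi> i. sqrt (\<pi> $ i) * w $ i)" for w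
  have S: "S a \<bullet> S b = inner_wt \<pi> a b" for a b
    unfolding S_def inner_wt_def inner_vec_def
  proof (rule sum.cong[OF refl])
    fix i
    have "sqrt (\<pi> $ i) * sqrt (\<pi> $ i) = \<pi> $ i"
      using pos[of i] by simp
    then show "(\<chi> i. sqrt (\<pi> $ i) * a $ i) $ i \<bullet> (\<chi> i. sqrt (\<pi> $ i) * b $ i) $ i
        = \<pi> $ i * a $ i * b $ i"
      by (simp add: mult_ac)
  qed
  define B where "B = (\<lambda>k. S (f k)) ` I"
  have inj: "inj_on (\<lambda>k. S (f k)) I"
    by (rule inj_onI) (metis S orth zero_neq_one)
  have pw: "pairwise orthogonal B"
    unfolding pairwise_def B_def orthogonal_def using S orth by auto
  have norm1: "norm b = 1" if "b \<in> B" for b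
    using that S orth unfolding B_def by (auto simp: norm_eq_1)
  have "0 \<notin> B"
    using norm1 by force
  then have "independent B"
    by (rule pairwise_orthogonal_independent[OF pw])
  moreover have "card B = DIM(real^'n)"
    unfolding B_def using inj card_I by (simp add: card_image)
  ultimately have "UNIV \<subseteq> span B"
    by (intro card_ge_dim_independent) auto
  then have in_span: "S v \<in> span B"
    by blast
  have "S v = (\<Sum>b\<in>B. (b \<bullet> S v) *\<^sub>R b)"
    using orthonormal_basis_expand[OF pw norm1 in_span] fin
    by (simp add: B_def inner_commute)
  also have "\<dots> = (\<Sum>k\<in>I. inner_wt \<pi> (f k) v *\<^sub>R S (f k))"
    unfolding B_def using inj by (simp add: sum.reindex S)
  finally have "S u \<bullet> S v = (\<Sum>k\<in>I. inner_wt \<pi> (f k) v * (S u \<bullet> S (f k)))"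
    by (simp add: inner_sum_right)
  then show ?thesis
    by (simp add: S mult.commute inner_wt_commute[of \<pi> u])
qed

text \<open>Reversibility is the self-adjointness of \<open>G\<close>; detailed balance lets the two sums be swapped.\<close>

lemma detailed_balance_self_adjoint:
  fixes G :: "real^'n^'n::finite"
  assumes db: "\<And>i j. \<pi> $ i * G $ i $ j = \<pi> $ j * G $ j $ i"
  shows "inner_wt \<pi> u (G *v v) = inner_wt \<pi> (G *v u) v"
proof -
  have "inner_wt \<pi> u (G *v v) = (\<Sum>i\<in>UNIV. \<Sum>j\<in>UNIV. (\<pi> $ i * G $ i $ j) * u $ i * v $ j)"
    by (simp add: inner_wt_def matrix_vector_mult_def sum_distrib_left mult_ac)
  also have "\<dots> = (\<Sum>j\<in>UNIV. \<Sum>i\<in>UNIV. (\<pi> $ j * G $ j $ i) * u $ i * v $ j)"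
    by (subst sum.swap) (simp add: db)
  also have "\<dots> = inner_wt \<pi> (G *v u) v"
    by (simp add: inner_wt_def matrix_vector_mult_def sum_distrib_left sum_distrib_right mult_ac)
  finally show ?thesis .
qed

text \<open>
  A self-adjoint projector onto the line of a unit vector \<open>e\<close> can only be \<open>v \<mapsto> \<langle>e, v\<rangle> e\<close>; this
  identifies the weights \<open>\<langle>x, \<Pi> x\<rangle>\<close> as squared coordinates.
\<close>

lemma inner_wt_rank_one_projector:
  fixes Q :: "real^'n^'n::finite"
  assumes idem: "Q ** Q = Q"
    and adj: "\<And>u v. inner_wt \<pi> (Q *v u) v = inner_wt \<pi> u (Q *v v)"
    and range: "range (\<lambda>v. Q *v v) = span {e}"
    and unit: "inner_wt \<pi> e e = 1"
  shows "inner_wt \<pi> x (Q *v x) = (inner_wt \<pi> e x)\<^sup>2"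
proof -
  have "e \<in> range (\<lambda>v. Q *v v)"
    using range by (simp add: span_base)
  then obtain y where "e = Q *v y"
    by auto
  then have Qe: "Q *v e = e"
    by (metis idem matrix_vector_mul_assoc)
  have "Q *v x \<in> span {e}"
    using range by blast
  then obtain c where c: "Q *v x = c *\<^sub>R e"
    by (auto simp: span_singleton)
  have "inner_wt \<pi> e x = inner_wt \<pi> e (Q *v x)"
    using adj[of e x] by (simp add: Qe)
  then have "inner_wt \<pi> e x = c"
    by (simp add: c inner_wt_scaleR_right unit)
  then show ?thesis
    by (simp add: c inner_wt_scaleR_right inner_wt_commute[of \<pi> x] power2_eq_square)
qed

section \<open>The semigroup in the eigenbasis of its generator\<close>

text \<open>
  Only the left eigenvector equation for the functional \<open>\<langle>e, \<cdot>\<rangle>\<close> enters, so that the lemma covers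
  both eigenvectors of a self-adjoint generator and the stationary vector (\<open>e = 1\<close>, \<open>c = 0\<close>).
\<close>

lemma generator_eigen_decay:
  fixes P :: "real \<Rightarrow> real^'n^'n::finite"
  assumes gen: "is_generator P G"
    and eig: "\<And>v. inner_wt \<pi> e (G *v v) = c * inner_wt \<pi> e v"
    and "0 \<le> t"
  shows "inner_wt \<pi> e (P t *v u) = exp (- c * t) * inner_wt \<pi> e u"
proof -
  define L where "L A = inner_wt \<pi> e (A *v u)" for A :: "real^'n^'n"
  have "linear L"
    by (rule linearI)
      (auto simp: L_def inner_wt_def matrix_vector_mult_def sum_distrib_left sum.distrib[symmetric]
        algebra_simps)
  then have L: "bounded_linear L"
    by (rule linear_linear[THEN iffD2])
  have P_deriv: "(P has_vector_derivative - (G ** P s)) (at s within {0..})" if "0 \<le> s" for s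
    using gen that by (simp add: is_generator_def)
  have L_gen: "L (- (G ** P s)) = - c * L (P s)" for s
    using linear_neg[OF \<open>linear L\<close>]
    by (simp add: L_def matrix_vector_mul_assoc[symmetric] eig)
  have L_deriv: "((\<lambda>s. L (P s)) has_real_derivative - c * L (P s)) (at s within {0..})"
    if "0 \<le> s" for s
    using bounded_linear.has_vector_derivative[OF L P_deriv[OF that]] L_gen[of s]
    by (simp add: has_real_derivative_iff_has_vector_derivative)
  \<comment> \<open>The integrating factor makes the solution constant on the half line.\<close>
  have "((\<lambda>s. exp (c * s) * L (P s)) has_real_derivative 0) (at s within {0..})"
    if "s \<in> {0..}" for s
    using that by (auto intro!: derivative_eq_intros L_deriv simp: algebra_simps)
  then obtain C where C: "\<And>s. 0 \<le> s \<Longrightarrow> exp (c * s) * L (P s) = C"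
    using has_field_derivative_zero_constant[of "{0::real..}" "\<lambda>s. exp (c * s) * L (P s)"] by auto
  have "exp (c * t) * L (P t) = L (P 0)"
    using C[OF \<open>0 \<le> t\<close>] C[of 0] by simp
  also have "L (P 0) = inner_wt \<pi> e u"
    using gen by (simp add: L_def is_generator_def)
  finally show ?thesis
    by (simp add: L_def exp_minus field_simps)
qed

text \<open>Otherwise \<open>\<langle>e, P(t) e\<rangle>\<close> would grow without bound, although \<open>P(t)\<close> has entries in \<open>[0, 1]\<close>.\<close>

lemma generator_eigenvalue_nonneg:
  fixes P :: "real \<Rightarrow> real^'n^'n::finite"
  assumes gen: "is_generator P G"
    and nonneg: "\<And>t i j. 0 \<le> t \<Longrightarrow> 0 \<le> P t $ i $ j"
    and rows: "\<And>t i. 0 \<le> t \<Longrightarrow> (\<Sum>j\<in>UNIV. P t $ i $ j) = 1"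
    and eig: "\<And>v. inner_wt \<pi> e (G *v v) = c * inner_wt \<pi> e v"
    and unit: "inner_wt \<pi> e e = 1"
  shows "0 \<le> c"
proof (rule ccontr)
  assume "\<not> 0 \<le> c"
  then have c: "c < 0" by simp
  define K where "K = (\<Sum>i\<in>UNIV. \<bar>\<pi> $ i * e $ i\<bar> * (\<Sum>j\<in>UNIV. \<bar>e $ j\<bar>))"
  have bound: "exp (- c * t) \<le> K" if "0 \<le> t" for t
  proof -
    have le1: "P t $ i $ j \<le> 1" for i j
      using member_le_sum[of j UNIV "\<lambda>j. P t $ i $ j"] nonneg[OF that] rows[OF that, of i] by simp
    have row: "\<bar>(P t *v e) $ i\<bar> \<le> (\<Sum>j\<in>UNIV. \<bar>e $ j\<bar>)" for i
      unfolding matrix_vector_mult_def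
      by (auto intro!: order_trans[OF sum_abs] sum_mono
          simp: abs_mult nonneg[OF that] mult_left_le_one_le le1)
    have "exp (- c * t) = inner_wt \<pi> e (P t *v e)"
      using generator_eigen_decay[OF gen eig that] unit by simp
    also have "\<dots> \<le> (\<Sum>i\<in>UNIV. \<bar>\<pi> $ i * e $ i\<bar> * \<bar>(P t *v e) $ i\<bar>)"
      unfolding inner_wt_def by (intro sum_mono) (metis abs_ge_self abs_mult)
    also have "\<dots> \<le> K"
      unfolding K_def by (intro sum_mono mult_left_mono row) auto
    finally show ?thesis .
  qed
  \<comment> \<open>At \<open>t = K / (- c)\<close> the bound reads \<open>exp K \<le> K\<close>.\<close>
  have "1 \<le> K"
    using bound[of 0] by simp
  then have "exp K \<le> K"
    using bound[of "K / (- c)"] c by (simp add: divide_nonneg_neg)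
  then show False
    using exp_ge_add_one_self[of K] by linarith
qed

lemma stationary_vector_generator:
  assumes "stationary_vector G \<pi>"
  shows "inner_wt \<pi> 1 (G *v v) = 0"
proof -
  have "inner_wt \<pi> 1 (G *v v) = \<pi> \<bullet> (G *v v)"
    by (simp add: inner_wt_def inner_vec_def)
  also have "\<dots> = (\<pi> v* G) \<bullet> v"
    by (simp add: dot_lmul_matrix)
  finally show ?thesis
    using assms by (simp add: stationary_vector_def)
qed

text \<open>This is \<open>\<pi> P(t) = \<pi>\<close>, tested against a vector.\<close>

lemma stationary_semigroup:
  fixes P :: "real \<Rightarrow> real^'n^'n::finite"
  assumes gen: "is_generator P G" and stat: "stationary_vector G \<pi>" and "0 \<le> t"
  shows "inner_wt \<pi> 1 (P t *v u) = inner_wt \<pi> 1 u"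
proof -
  have "inner_wt \<pi> 1 (G *v v) = 0 * inner_wt \<pi> 1 v" for v
    by (simp add: stationary_vector_generator[OF stat])
  from generator_eigen_decay[OF gen this \<open>0 \<le> t\<close>] show ?thesis
    by simp
qed

lemma stationary_semigroup_component:
  fixes P :: "real \<Rightarrow> real^'n^'n::finite"
  assumes "is_generator P G" "stationary_vector G \<pi>" "0 \<le> t"
  shows "(\<Sum>i\<in>UNIV. \<pi> $ i * P t $ i $ j) = \<pi> $ j"
  using stationary_semigroup[OF assms, of "axis j 1"]
  by (simp add: inner_wt_def matrix_vector_mult_basis column_def)
    (simp add: axis_def if_distrib[of "(*) _"] cong: if_cong)

text \<open>A state of stationary mass \<open>0\<close> could not be reached from one of positive mass.\<close>

lemma stationary_vector_pos:
  fixes P :: "real \<Rightarrow> real^'n^'n::finite"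
  assumes gen: "is_generator P G" and stat: "stationary_vector G \<pi>"
    and irr: "irreducible_chain P"
    and nonneg: "\<And>t i j. 0 \<le> t \<Longrightarrow> 0 \<le> P t $ i $ j"
  shows "0 < \<pi> $ j"
proof (rule ccontr)
  assume "\<not> 0 < \<pi> $ j"
  moreover have pi: "0 \<le> \<pi> $ i" for i
    using stat by (simp add: stationary_vector_def)
  ultimately have j: "\<pi> $ j = 0"
    by (simp add: order_antisym not_less)
  have "\<pi> $ i = 0" for i
  proof -
    obtain t where t: "0 \<le> t" "0 < P t $ i $ j"
      using irr by (auto simp: irreducible_chain_def)
    have "(\<Sum>i\<in>UNIV. \<pi> $ i * P t $ i $ j) = 0"
      using stationary_semigroup_component[OF gen stat t(1)] j by simp
    then have "\<pi> $ i * P t $ i $ j = 0"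
      by (subst (asm) sum_nonneg_eq_0_iff) (auto simp: pi nonneg[OF t(1)])
    then show ?thesis
      using t(2) by simp
  qed
  then show False
    using stat by (simp add: stationary_vector_def)
qed

section \<open>Covariances of the stationary chain\<close>

lemma (in prob_space) expectation_finite_type:
  fixes Y :: "'a \<Rightarrow> 'b::finite" and g :: "'b \<Rightarrow> real"
  assumes Y: "Y \<in> measurable M (count_space UNIV)"
  shows "(LINT w|M. g (Y w)) = (\<Sum>y\<in>UNIV. g y * \<P>(w in M. Y w = y))"
proof -
  have sets: "{w \<in> space M. Y w = y} \<in> sets M" for y
    using measurable_sets[OF Y, of "{y}"] by (simp add: vimage_def Int_def conj_commute)
  have "(LINT w|M. g (Y w))
      = (LINT w|M. (\<Sum>y\<in>UNIV. g y * indicator {w \<in> space M. Y w = y} w))"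
    by (rule Bochner_Integration.integral_cong)
      (auto simp: indicator_def if_distrib[of "(*) _"] cong: if_cong)
  also have "\<dots> = (\<Sum>y\<in>UNIV. g y * \<P>(w in M. Y w = y))"
    using sets by (subst Bochner_Integration.integral_sum) (auto simp: emeasure_eq_measure)
  finally show ?thesis .
qed

context hctmc
begin

lemma events_X: "0 \<le> t \<Longrightarrow> {w \<in> space M. X t w = i} \<in> events"
  using measurable_sets[OF measurable_X, of t "{i}"] by (simp add: vimage_def Int_def conj_commute)

text \<open>The case of a null event \<open>X\<^sub>s = i\<close> is separate: there the Markov property says nothing.\<close>

lemma joint_law:
  assumes s: "0 \<le> s" and \<tau>: "0 \<le> \<tau>"
  shows "\<P>(w in M. X (s + \<tau>) w = j \<and> X s w = i) = \<P>(w in M. X s w = i) * P \<tau> $ i $ j"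
proof (cases "\<P>(w in M. X s w = i) = 0")
  case True
  have "\<P>(w in M. X (s + \<tau>) w = j \<and> X s w = i) \<le> \<P>(w in M. X s w = i)"
    by (rule finite_measure_mono) (auto simp: events_X s)
  then show ?thesis
    using True by (simp add: order_antisym)
next
  case False
  then have pos: "0 < \<P>(w in M. X s w = i)"
    by (simp add: zero_less_measure_iff)
  then show ?thesis
    using markov[of "{}" s \<tau> i undefined j] s \<tau>
    by (simp add: cond_prob_def field_simps)
qed

lemma stationary_law:
  assumes gen: "is_generator P G" and stat: "stationary_vector G \<pi>"
    and init: "\<And>i. \<P>(w in M. X 0 w = i) = \<pi> $ i" and t: "0 \<le> t"
  shows "\<P>(w in M. X t w = j) = \<pi> $ j"
proof -
  have "\<P>(w in M. X t w = j) = measure M (\<Union>i\<in>UNIV. {w \<in> space M. X t w = j \<and> X 0 w = i})"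
    by (rule arg_cong[where f = "measure M"]) auto
  also have "\<dots> = (\<Sum>i\<in>UNIV. \<P>(w in M. X t w = j \<and> X 0 w = i))"
    by (rule finite_measure_finite_Union)
      (auto simp: disjoint_family_on_def intro!: sets.sets_Collect_conj events_X t)
  also have "\<dots> = (\<Sum>i\<in>UNIV. \<pi> $ i * P t $ i $ j)"
    using joint_law[of 0 t j] t by (simp add: init)
  also have "\<dots> = \<pi> $ j"
    by (rule stationary_semigroup_component[OF gen stat t])
  finally show ?thesis .
qed

lemma stationary_lagged_covariance:
  assumes gen: "is_generator P G" and stat: "stationary_vector G \<pi>"
    and init: "\<And>i. \<P>(w in M. X 0 w = i) = \<pi> $ i" and t: "0 \<le> t" and \<tau>: "0 \<le> \<tau>"
  shows "lagged_covariance M X x \<tau> t = inner_wt \<pi> x (P \<tau> *v x) - (inner_wt \<pi> 1 x)\<^sup>2"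
proof -
  define m where "m = inner_wt \<pi> 1 x"
  have mean: "mean_value M X x s = m" if "0 \<le> s" for s
    unfolding mean_value_def expectation_finite_type[OF measurable_X[OF that]]
    by (simp add: stationary_law[OF gen stat init that] m_def inner_wt_def mult.commute)
  have Y: "(\<lambda>w. (X (t + \<tau>) w, X t w)) \<in> measurable M (count_space UNIV)"
    using measurable_Pair[OF measurable_X[of "t + \<tau>"] measurable_X[of t]] t \<tau>
    by (simp add: pair_measure_countable)
  have "lagged_covariance M X x \<tau> t = (LINT w|M. (x $ X (t + \<tau>) w - m) * (x $ X t w - m))"
    using mean t \<tau> by (simp add: lagged_covariance_def)
  also have "\<dots> = (\<Sum>(j, i)\<in>UNIV. (x $ j - m) * (x $ i - m) *
      \<P>(w in M. X (t + \<tau>) w = j \<and> X t w = i))"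
    using expectation_finite_type[OF Y, of "\<lambda>(j, i). (x $ j - m) * (x $ i - m)"]
    by (simp add: case_prod_beta prod_eq_iff)
  also have "\<dots> = (\<Sum>j\<in>UNIV. \<Sum>i\<in>UNIV. (x $ j - m) * (x $ i - m) * (\<pi> $ i * P \<tau> $ i $ j))"
    by (simp add: UNIV_Times_UNIV[symmetric] sum.cartesian_product joint_law t \<tau>
        stationary_law[OF gen stat init t] del: UNIV_Times_UNIV)
  also have "\<dots> = (\<Sum>i\<in>UNIV. \<Sum>j\<in>UNIV. (x $ j - m) * (x $ i - m) * (\<pi> $ i * P \<tau> $ i $ j))"
    by (rule sum.swap)
  \<comment> \<open>Expanding the product leaves three terms besides \<open>\<langle>x, P(\<tau>) x\<rangle>\<close>;
    by the row sums of \<open>P(\<tau>)\<close> and the invariance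
    of \<open>\<pi>\<close> these contribute \<open>- m\<^sup>2 - m\<^sup>2 + m\<^sup>2\<close>.\<close>
  also have "\<dots> = (\<Sum>i\<in>UNIV. \<pi> $ i * x $ i * (P \<tau> *v x) $ i - m * (\<pi> $ i * (P \<tau> *v x) $ i)
      - m * (\<pi> $ i * x $ i) + m\<^sup>2 * \<pi> $ i)"
  proof (rule sum.cong[OF refl])
    fix i
    have "(\<Sum>j\<in>UNIV. (x $ j - m) * (x $ i - m) * (\<pi> $ i * P \<tau> $ i $ j))
        = \<pi> $ i * (x $ i - m) * ((\<Sum>j\<in>UNIV. P \<tau> $ i $ j * x $ j) - m * (\<Sum>j\<in>UNIV. P \<tau> $ i $ j))"
      by (simp add: sum_distrib_left sum_subtractf[symmetric] algebra_simps)
    also have "\<dots> = \<pi> $ i * (x $ i - m) * ((P \<tau> *v x) $ i - m)"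
      by (simp add: transition_sum[OF \<tau>] matrix_vector_mult_def)
    finally show "(\<Sum>j\<in>UNIV. (x $ j - m) * (x $ i - m) * (\<pi> $ i * P \<tau> $ i $ j))
        = \<pi> $ i * x $ i * (P \<tau> *v x) $ i - m * (\<pi> $ i * (P \<tau> *v x) $ i)
          - m * (\<pi> $ i * x $ i) + m\<^sup>2 * \<pi> $ i"
      by (simp add: algebra_simps power2_eq_square)
  qed
  also have "\<dots> = inner_wt \<pi> x (P \<tau> *v x) - m * inner_wt \<pi> 1 (P \<tau> *v x)
      - m * inner_wt \<pi> 1 x + m\<^sup>2 * (\<Sum>i\<in>UNIV. \<pi> $ i)"
    by (simp add: inner_wt_def sum.distrib sum_subtractf sum_distrib_left)
  also have "\<dots> = inner_wt \<pi> x (P \<tau> *v x) - m\<^sup>2"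
    using stat stationary_semigroup[OF gen stat \<tau>]
    by (simp add: m_def[symmetric] stationary_vector_def power2_eq_square)
  finally show ?thesis
    by (simp add: m_def)
qed

end

section \<open>The spectral density\<close>

theorem theorem5:
  fixes M :: "'w measure"
    and X :: "real \<Rightarrow> 'w \<Rightarrow> 'n::finite"
    and P :: "real \<Rightarrow> real^'n^'n"
    and G :: "real^'n^'n"
    and \<pi> x :: "real^'n"
    and \<omega>s :: "nat \<Rightarrow> real"
    and Proj :: "nat \<Rightarrow> real^'n^'n"
    and \<omega> :: real
  assumes "hctmc M X P"
    and "is_generator P G"
    and "irreducible_chain P"
    and "stationary_vector G \<pi>"
    and "reversible_chain M X G \<pi>"
    and "nonzero_eigenvalues G \<omega>s"
    and "spectral_projectors \<pi> G \<omega>s Proj"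
  shows "psd_exists M X x \<omega> \<and>
    power_spectral_density M X x \<omega> =
      (\<Sum>k=1..CARD('n) - 1.
         inner_wt \<pi> x (Proj k *v x) * (\<omega>s k / ((\<omega>s k)\<^sup>2 + \<omega>\<^sup>2)))"
proof -
  interpret hctmc M X P by fact
  have gen: "is_generator P G" and stat: "stationary_vector G \<pi>" by fact+
  have db: "\<pi> $ i * G $ i $ j = \<pi> $ j * G $ j $ i"
    and init: "\<P>(w in M. X 0 w = i) = \<pi> $ i" for i j
    using assms(5) by (auto simp: reversible_chain_def)
  let ?I = "{1..CARD('n) - 1}"
  obtain e :: "nat \<Rightarrow> real^'n" where e:
      "\<forall>k\<in>?I. \<forall>l\<in>?I. inner_wt \<pi> (e k) (e l) = (if k = l then 1 else 0)"
      "\<forall>k\<in>?I. G *v e k = \<omega>s k *\<^sub>R e k \<and> Proj k ** Proj k = Proj k \<and>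
         (\<forall>u v. inner_wt \<pi> (Proj k *v u) v = inner_wt \<pi> u (Proj k *v v)) \<and>
         range (\<lambda>v. Proj k *v v) = span {e k}"
    using assms(7) unfolding spectral_projectors_def by (elim exE conjE) (rule that)
  have orth: "inner_wt \<pi> (e k) (e l) = (if k = l then 1 else 0)" if "k \<in> ?I" "l \<in> ?I" for k l
    using e(1) that by blast
  have eig: "G *v e k = \<omega>s k *\<^sub>R e k"
    and idem: "Proj k ** Proj k = Proj k"
    and adj: "inner_wt \<pi> (Proj k *v u) v = inner_wt \<pi> u (Proj k *v v)"
    and range: "range (\<lambda>v. Proj k *v v) = span {e k}" if "k \<in> ?I" for k u v
    using e(2) that by blast+
  have pos: "0 < \<pi> $ i" for i
    by (rule stationary_vector_pos[OF gen stat assms(3) transition_nonneg])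
  have left_eig: "inner_wt \<pi> (e k) (G *v v) = \<omega>s k * inner_wt \<pi> (e k) v" if "k \<in> ?I" for k v
    unfolding detailed_balance_self_adjoint[OF db] eig[OF that]
    by (metis inner_wt_commute inner_wt_scaleR_right)
  have \<omega>_pos: "0 < \<omega>s k" if k: "k \<in> ?I" for k
  proof -
    have "\<omega>s k \<in># image_mset \<omega>s (mset_set ?I)"
      using k by simp
    then have "\<omega>s k \<noteq> 0"
      using assms(6) unfolding nonzero_eigenvalues_def by (metis (mono_tags) mem_Collect_eq set_mset_filter)
    moreover have "0 \<le> \<omega>s k"
      by (rule generator_eigenvalue_nonneg[OF gen transition_nonneg transition_sum left_eig[OF k]])
        (use orth[OF k k] in simp_all)
    ultimately show ?thesis by simp
  qed
  \<comment> \<open>The index \<open>0\<close> completes the eigenvectors \<open>e\<^sub>k\<close> by the constant one.\<close>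
  define f where "f k = (if k = 0 then 1 else e k)" for k
  have ortho_const: "inner_wt \<pi> 1 (e k) = 0" if k: "k \<in> ?I" for k
  proof -
    have "\<omega>s k * inner_wt \<pi> 1 (e k) = 0"
      using stationary_vector_generator[OF stat, of "e k"] by (simp add: eig[OF k] inner_wt_scaleR_right)
    then show ?thesis
      using \<omega>_pos[OF k] by simp
  qed
  have unit_const: "inner_wt \<pi> 1 1 = 1"
    using stat by (simp add: inner_wt_def stationary_vector_def)
  have orth_f: "inner_wt \<pi> (f k) (f l) = (if k = l then 1 else 0)"
    if "k \<in> {..<CARD('n)}" "l \<in> {..<CARD('n)}" for k l
  proof -
    have I: "k \<in> ?I" if "k < CARD('n)" "k \<noteq> 0" for k
      using that by simp
    show ?thesis
    proof (cases "k = 0"; cases "l = 0")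
      assume "k = 0" "l = 0"
      then show ?thesis by (simp add: f_def unit_const)
    next
      assume "k = 0" "l \<noteq> 0"
      then show ?thesis using that ortho_const[OF I, of l] by (simp add: f_def)
    next
      assume "k \<noteq> 0" "l = 0"
      then show ?thesis
        using that ortho_const[OF I, of k] by (simp add: f_def inner_wt_commute[of \<pi> _ 1])
    next
      assume "k \<noteq> 0" "l \<noteq> 0"
      then show ?thesis using that orth[OF I I, of k l] by (simp add: f_def)
    qed
  qed
  have split: "{..<CARD('n)} = insert 0 ?I"
    using zero_less_card_finite[where 'a = 'n] by auto
  define g where "g k = inner_wt \<pi> x (Proj k *v x)" for k
  have g: "g k = (inner_wt \<pi> (e k) x)\<^sup>2" if k: "k \<in> ?I" for k
    unfolding g_def
    by (rule inner_wt_rank_one_projector[OF idem[OF k] adj[OF k] range[OF k]])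
      (use orth[OF k k] in simp)
  have cov: "lagged_covariance M X x \<tau> t = (\<Sum>k\<in>?I. g k * exp (- \<omega>s k * \<tau>))"
    if \<tau>: "0 \<le> \<tau>" and t: "0 \<le> t" for \<tau> t
  proof -
    have "inner_wt \<pi> x (P \<tau> *v x)
        = (\<Sum>k<CARD('n). inner_wt \<pi> (f k) x * inner_wt \<pi> (f k) (P \<tau> *v x))"
      by (rule inner_wt_Parseval) (use pos orth_f in auto)
    also have "\<dots> = (inner_wt \<pi> 1 x)\<^sup>2 + (\<Sum>k\<in>?I. inner_wt \<pi> (f k) x * inner_wt \<pi> (f k) (P \<tau> *v x))"
      by (simp add: split f_def stationary_semigroup[OF gen stat \<tau>] power2_eq_square)
    also have "(\<Sum>k\<in>?I. inner_wt \<pi> (f k) x * inner_wt \<pi> (f k) (P \<tau> *v x))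
        = (\<Sum>k\<in>?I. g k * exp (- \<omega>s k * \<tau>))"
    proof (rule sum.cong[OF refl])
      fix k assume k: "k \<in> ?I"
      then show "inner_wt \<pi> (f k) x * inner_wt \<pi> (f k) (P \<tau> *v x) = g k * exp (- \<omega>s k * \<tau>)"
        using generator_eigen_decay[OF gen left_eig[OF k] \<tau>, of x]
        by (simp add: f_def g power2_eq_square)
    qed
    finally show ?thesis
      using stationary_lagged_covariance[OF gen stat init t \<tau>] by simp
  qed
  have lim: "(lagged_covariance M X x \<tau> \<longlongrightarrow> (\<Sum>k\<in>?I. g k * exp (- \<omega>s k * \<tau>))) at_top"
    if "0 \<le> \<tau>" for \<tau>
    by (rule tendsto_eventually)
      (use cov[OF that] in \<open>auto intro: eventually_mono[OF eventually_ge_at_top[of 0]]\<close>)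
  have integrand: "autocorrelation M X x \<tau> * cos (\<omega> * \<tau>)
      = (\<Sum>k\<in>?I. g k * (exp (- \<omega>s k * \<tau>) * cos (\<omega> * \<tau>)))" if "\<tau> \<in> {0..}" for \<tau>
    using tendsto_Lim[OF trivial_limit_at_top_linorder lim[of \<tau>]] that
    by (simp add: autocorrelation_def sum_distrib_right mult.assoc)
  have int_k: "set_integrable lborel {0..} (\<lambda>\<tau>. g k * (exp (- \<omega>s k * \<tau>) * cos (\<omega> * \<tau>)))"
    if "k \<in> ?I" for k
    by (intro set_integrable_mult_right exp_cos_integrable_Ici \<omega>_pos that)
  have "set_integrable lborel {0..} (\<lambda>\<tau>. \<Sum>k\<in>?I. g k * (exp (- \<omega>s k * \<tau>) * cos (\<omega> * \<tau>)))"
    using int_k unfolding set_integrable_def scaleR_sum_right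
    by (intro Bochner_Integration.integrable_sum)
  moreover have "set_integrable lborel {0..} (\<lambda>\<tau>. autocorrelation M X x \<tau> * cos (\<omega> * \<tau>)) \<longleftrightarrow>
      set_integrable lborel {0..} (\<lambda>\<tau>. \<Sum>k\<in>?I. g k * (exp (- \<omega>s k * \<tau>) * cos (\<omega> * \<tau>)))"
    by (intro set_integrable_cong refl integrand)
  ultimately have int: "set_integrable lborel {0..} (\<lambda>\<tau>. autocorrelation M X x \<tau> * cos (\<omega> * \<tau>))"
    by (rule iffD2[rotated])
  have "psd_exists M X x \<omega>"
    unfolding psd_exists_def using lim int by (intro conjI allI impI exI)
  moreover have "power_spectral_density M X x \<omega> = (\<Sum>k\<in>?I. g k * (\<omega>s k / ((\<omega>s k)\<^sup>2 + \<omega>\<^sup>2)))"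
  proof -
    have "power_spectral_density M X x \<omega>
        = (LINT \<tau>:{0..}|lborel. (\<Sum>k\<in>?I. g k * (exp (- \<omega>s k * \<tau>) * cos (\<omega> * \<tau>))))"
      unfolding power_spectral_density_def
      by (intro set_lebesgue_integral_cong) (use integrand in auto)
    also have "\<dots> = (\<Sum>k\<in>?I. LINT \<tau>:{0..}|lborel. g k * (exp (- \<omega>s k * \<tau>) * cos (\<omega> * \<tau>)))"
      using int_k unfolding set_lebesgue_integral_def set_integrable_def scaleR_sum_right
      by (intro Bochner_Integration.integral_sum)
    also have "\<dots> = (\<Sum>k\<in>?I. g k * (\<omega>s k / ((\<omega>s k)\<^sup>2 + \<omega>\<^sup>2)))"
      using exp_cos_integral_Ici[OF \<omega>_pos, of _ \<omega>] by (intro sum.cong) auto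
    finally show ?thesis .
  qed
  ultimately show ?thesis
    by (simp add: g_def)
qed

end
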